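(* Let $l\in\mathbb N^+$ and let the perturbation satisfy $Q(q,\dot q,t;T,e,0)=e f_e\cos(\Omega t)-C(q,\dot q)$, $\Omega=2\pi/T$, with $e\in\mathbb R$, $f_e\in\mathbb R^N$ a constant unit vector and $C$ a smooth dissipative vector field. Consider a perturbed periodic orbit $q_{qz}(t;\xi,T,\varepsilon)$ corresponding to a quadratic zero of the Melnikov function $M^{1:l}(s,e)$ related to the conservative limit $\mathcal Z$. Then the $l$-th harmonic of the function $\langle q_{qz}(t;\xi,T,\varepsilon),f_e\rangle$ has a phase lag (resp. lead) of $90^\circ+O(\varepsilon)$ with respect to the forcing signal if $eR>0$ (resp. $eR<0$).
   Context: **Mechanical system.** Let $N\ge1$, $n=2N$, $U\subset\mathbb R^N$ open, $q\in U$. The energy is $H(q,\dot q)=E(q,\dot q)+V(q)=\tfrac12\langle\dot q,\mathbf M(q)\dot q\rangle+V(q)$, with $\mathbf M(q)$ symmetric positive definite. The equations of motion are $\mathbf M(q)\ddot q+G(q,\dot q)+DV(q)=\varepsilon Q(q,\dot q,t;T,e,\varepsilon)$, with $\varepsilon\ge0$ small, $G(q,\dot q)=D_t(\mathbf M(q))\dot q-D_qE(q,\dot q)$, and $Q$ $T$-periodic in $t$; equivalently $\dot x=f(x)+\varepsilon g$ for $x=(q,\dot q)$, with $f=(\dot q,-\mathbf M^{-1}(DV+G))$ and $g=(0,\mathbf M^{-1}Q)$, where $f\in C^r$, $g$ is $C^{r-1}$ in $t$ and $C^r$ in the other arguments, $r\ge2$. $x(t;\xi,T,\varepsilon)=(q(t;\xi,T,\varepsilon),\dot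 q(t;\xi,T,\varepsilon))$ is the trajectory from $\xi$ at $t=0$; $x_0(t;\xi)=(q_0(t;\xi),\dot q_0(t;\xi))=x(t;\xi,T,0)$. **Conservative orbit.** $\mathcal Z$ is a $1$-normal periodic orbit of $\dot x=f(x)$ of minimal period $\tau=2\pi/\omega$, with $p\in\mathcal Z$. Here $1$-normal means that, with monodromy matrix $\Pi(p)=Y(\tau;p)$ ($\dot Y=Df(x_0(t;p))Y$, $Y(0)=I$), the eigenvalue $+1$ of $\Pi(p)$ has geometric multiplicity $1$, or has geometric multiplicity $2$ and $f(p)\notin\mathrm{range}(\Pi(p)-I)$. **Melnikov function.** $$M^{1:l}(s,e)=\int_0^{\tau}\big\langle\dot q_0(t+s;p),\,e f_e\cos\big(\tfrac{2l\pi}{\tau}t\big)-C(q_0(t+s;p),\dot q_0(t+s;p))\big\rangle dt ,$$ and $R=\int_0^\tau\langle\dot q_0(t;p),C(q_0(t;p),\dot q_0(t;p))\rangle dt$ is the resistance. A quadratic zero of $M^{1:l}$ is a point $(s_{qz},e)$ at which $M^{1:l}=D_sM^{1:l}=0$ and $D^2_{ss}M^{1:l}\neq0$. **Perturbed orbit corresponding to a quadratic zero.** For small $\varepsilon>0$, an $lT$-periodic solution $q_{qz}(t;\xi,T,\varepsilon)$ of the perturbed system (with forcing amplitude parameter $O(\varepsilon)$-close to that of the quadratic zero), with $\xi=x_0(s_{qz};p)+O(\varepsilon)$ and $lT=\tau+O(\varepsilon)$. **Phase.** The forcing signal is $\cos(\Omega t)$. The $l$-th harmonic is the $l$-th Fourier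 term of the $lT$-periodic function $\langle q_{qz},f_e\rangle$, which has frequency $\Omega$. It has a phase lag (lead) $\phi$ with respect to the forcing signal if it is of the form $c\cos(\Omega t-\phi)$ (resp. $c\cos(\Omega t+\phi)$) with $c>0$. *)

theory Defs
  imports "HOL-Analysis.Analysis" "HOL-Library.Landau_Symbols"
begin

section \<open>Smoothness classes\<close>

text \<open>
  All partial derivatives of \<open>F\<close> of order at most \<open>k\<close> in the coordinate directions \<open>D\<close> exist and
  are continuous on \<open>S\<close>, jointly in all variables. For \<open>D = Basis\<close> and \<open>S\<close> open this is \<open>C\<^sup>k\<close>.
  At points of \<open>S\<close> on the boundary, as for a parameter ranging over \<open>{0..<\<epsilon>\<^sub>0}\<close>, the partial
  derivatives are one-sided.
\<close>

primrec Ck_along :: "'a::euclidean_space set \<Rightarrow> nat \<Rightarrow> 'a set \<Rightarrow> ('a \<Rightarrow> 'b::real_normed_vector) \<Rightarrow> bool"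
where
  "Ck_along D 0 S F \<longleftrightarrow> continuous_on S F"
| "Ck_along D (Suc k) S F \<longleftrightarrow> continuous_on S F \<and>
     (\<forall>b\<in>D. \<exists>F'. (\<forall>x\<in>S. ((\<lambda>h. F (x + h *\<^sub>R b)) has_vector_derivative F' x)
                             (at 0 within {h. x + h *\<^sub>R b \<in> S})) \<and>
                 Ck_along D k S F')"

abbreviation Ck :: "nat \<Rightarrow> 'a::euclidean_space set \<Rightarrow> ('a \<Rightarrow> 'b::real_normed_vector) \<Rightarrow> bool" where
  "Ck \<equiv> Ck_along Basis"


section \<open>The mechanical system\<close>

type_synonym 'n state = "(real^'n) \<times> (real^'n)"

definition grad :: "(real^'n \<Rightarrow> real) \<Rightarrow> real^'n \<Rightarrow> real^'n" where
  "grad F q = (\<chi> i. frechet_derivative F (at q) (axis i 1))"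

definition kinetic :: "(real^'n \<Rightarrow> real^'n^'n) \<Rightarrow> real^'n \<Rightarrow> real^'n \<Rightarrow> real" where
  "kinetic M q v = 1/2 * (v \<bullet> (M q *v v))"

text \<open>Along a motion, \<open>D\<^sub>t (M(q))\<close> is the derivative of \<open>M\<close> in the direction of the velocity.\<close>

definition inertial_force :: "(real^'n \<Rightarrow> real^'n^'n) \<Rightarrow> real^'n \<Rightarrow> real^'n \<Rightarrow> real^'n" where
  "inertial_force M q v = frechet_derivative M (at q) v *v v - grad (\<lambda>q'. kinetic M q' v) q"

definition conservative_field ::
  "(real^'n \<Rightarrow> real^'n^'n) \<Rightarrow> (real^'n \<Rightarrow> real) \<Rightarrow> 'n state \<Rightarrow> 'n state" where
  "conservative_field M V = (\<lambda>(q, v). (v, - (matrix_inv (M q) *v (grad V q + inertial_force M q v))))"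

text \<open>The arguments of the perturbation \<open>Q\<close> are \<open>q\<close>, the velocity, \<open>t\<close>, \<open>T\<close>, \<open>e\<close>, \<open>\<epsilon>\<close>, in this order.\<close>

type_synonym 'n perturbation =
  "real^'n \<Rightarrow> real^'n \<Rightarrow> real \<Rightarrow> real \<Rightarrow> real \<Rightarrow> real \<Rightarrow> real^'n"

definition perturbing_field ::
  "(real^'n \<Rightarrow> real^'n^'n) \<Rightarrow> 'n perturbation \<Rightarrow> 'n state \<times> real \<times> real \<times> real \<times> real \<Rightarrow> 'n state" where
  "perturbing_field M Q = (\<lambda>((q, v), t, T, e, \<epsilon>). (0, matrix_inv (M q) *v Q q v t T e \<epsilon>))"

definition perturbing_domain ::
  "(real^'n) set \<Rightarrow> real \<Rightarrow> ('n state \<times> real \<times> real \<times> real \<times> real) set" where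
  "perturbing_domain U \<epsilon>0 = (U \<times> UNIV) \<times> UNIV \<times> {0<..} \<times> UNIV \<times> {0..<\<epsilon>0}"

definition time_direction :: "'n::finite state \<times> real \<times> real \<times> real \<times> real" where
  "time_direction = (0, 1, 0, 0, 0)"

text \<open>
  The perturbing field is \<open>C\<close> of order \<open>r - 1\<close> in \<open>t\<close> and of order \<open>r\<close> in the other arguments. Differentiability
  of \<open>M\<close> and \<open>V\<close> is only needed for the conservative field to be meaningful.
\<close>

definition mechanical_system ::
  "(real^'n) set \<Rightarrow> (real^'n \<Rightarrow> real^'n^'n) \<Rightarrow> (real^'n \<Rightarrow> real) \<Rightarrow> 'n perturbation \<Rightarrow>
   real \<Rightarrow> nat \<Rightarrow> bool" where
  "mechanical_system U M V Q \<epsilon>0 r \<longleftrightarrow>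
     open U \<and> \<epsilon>0 > 0 \<and> r \<ge> 2 \<and>
     (\<forall>q\<in>U. transpose (M q) = M q \<and> (\<forall>v. v \<noteq> 0 \<longrightarrow> v \<bullet> (M q *v v) > 0)) \<and>
     M differentiable_on U \<and> V differentiable_on U \<and>
     (\<forall>q\<in>U. \<forall>v t T e \<epsilon>. T > 0 \<longrightarrow> 0 \<le> \<epsilon> \<longrightarrow> \<epsilon> < \<epsilon>0 \<longrightarrow> Q q v (t + T) T e \<epsilon> = Q q v t T e \<epsilon>) \<and>
     Ck r (U \<times> UNIV) (conservative_field M V) \<and>
     Ck_along {time_direction} (r - 1) (perturbing_domain U \<epsilon>0) (perturbing_field M Q) \<and>
     Ck_along (Basis - {time_direction}) r (perturbing_domain U \<epsilon>0) (perturbing_field M Q)"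

text \<open>Dissipative: the resistive force \<open>- C\<close> never does positive work.\<close>

definition smooth_dissipative :: "(real^'n) set \<Rightarrow> (real^'n \<Rightarrow> real^'n \<Rightarrow> real^'n) \<Rightarrow> bool" where
  "smooth_dissipative U C \<longleftrightarrow>
     (\<forall>k. Ck k (U \<times> UNIV) (\<lambda>(q, v). C q v)) \<and> (\<forall>q\<in>U. \<forall>v. v \<bullet> C q v \<ge> 0)"

definition perturbed_trajectory ::
  "(real^'n) set \<Rightarrow> (real^'n \<Rightarrow> real^'n^'n) \<Rightarrow> (real^'n \<Rightarrow> real) \<Rightarrow> 'n perturbation \<Rightarrow>
   real \<Rightarrow> real \<Rightarrow> real \<Rightarrow> 'n state \<Rightarrow> (real \<Rightarrow> 'n state) \<Rightarrow> bool" where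
  "perturbed_trajectory U M V Q T e \<epsilon> \<xi> x \<longleftrightarrow>
     x 0 = \<xi> \<and>
     (\<forall>t. fst (x t) \<in> U \<and>
          (x has_vector_derivative
             (conservative_field M V (x t) + \<epsilon> *\<^sub>R perturbing_field M Q (x t, t, T, e, \<epsilon>))) (at t))"


section \<open>The conservative orbit\<close>

definition periodic_orbit ::
  "(real^'n) set \<Rightarrow> ('n state \<Rightarrow> 'n state) \<Rightarrow> real \<Rightarrow> 'n state \<Rightarrow> (real \<Rightarrow> 'n state) \<Rightarrow> bool" where
  "periodic_orbit U f \<tau> p x0 \<longleftrightarrow>
     x0 0 = p \<and>
     (\<forall>t. fst (x0 t) \<in> U \<and> (x0 has_vector_derivative f (x0 t)) (at t)) \<and>
     \<tau> > 0 \<and> (\<forall>t. x0 (t + \<tau>) = x0 t) \<and>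
     (\<forall>\<sigma>. 0 < \<sigma> \<and> \<sigma> < \<tau> \<longrightarrow> (\<exists>t. x0 (t + \<sigma>) \<noteq> x0 t))"

definition one_normal ::
  "('n state \<Rightarrow> 'n state) \<Rightarrow> real \<Rightarrow> 'n::finite state \<Rightarrow> (real \<Rightarrow> 'n state) \<Rightarrow> bool" where
  "one_normal f \<tau> p x0 \<longleftrightarrow>
     (\<exists>Y :: real \<Rightarrow> 'n state \<Rightarrow>\<^sub>L 'n state.
        Y 0 = id_blinfun \<and>
        (\<forall>t. (Y has_vector_derivative
                (Blinfun (frechet_derivative f (at (x0 t))) o\<^sub>L Y t)) (at t)) \<and>
        (let P = blinfun_apply (Y \<tau>) in
           dim {y. P y = y} = 1 \<or>
           (dim {y. P y = y} = 2 \<and> f p \<notin> range (\<lambda>y. P y - y))))"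


section \<open>The Melnikov function\<close>

definition melnikov ::
  "nat \<Rightarrow> real \<Rightarrow> (real \<Rightarrow> 'n state) \<Rightarrow> (real^'n \<Rightarrow> real^'n \<Rightarrow> real^'n) \<Rightarrow> real^'n \<Rightarrow> real \<Rightarrow> real \<Rightarrow> real"
where
  "melnikov l \<tau> x0 C fe s e =
     integral {0..\<tau>} (\<lambda>t. snd (x0 (t + s)) \<bullet>
       ((e * cos (2 * real l * pi / \<tau> * t)) *\<^sub>R fe - C (fst (x0 (t + s))) (snd (x0 (t + s)))))"

definition resistance ::
  "real \<Rightarrow> (real \<Rightarrow> 'n state) \<Rightarrow> (real^'n \<Rightarrow> real^'n \<Rightarrow> real^'n) \<Rightarrow> real" where
  "resistance \<tau> x0 C = integral {0..\<tau>} (\<lambda>t. snd (x0 t) \<bullet> C (fst (x0 t)) (snd (x0 t)))"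

definition quadratic_zero :: "(real \<Rightarrow> real \<Rightarrow> real) \<Rightarrow> real \<Rightarrow> real \<Rightarrow> bool" where
  "quadratic_zero F s e \<longleftrightarrow>
     F s e = 0 \<and> deriv (\<lambda>\<sigma>. F \<sigma> e) s = 0 \<and> deriv (deriv (\<lambda>\<sigma>. F \<sigma> e)) s \<noteq> 0"


section \<open>Perturbed periodic orbits\<close>

text \<open>
  A family, indexed by the small parameter \<open>\<epsilon> > 0\<close>, of \<open>l T(\<epsilon>)\<close>-periodic trajectories \<open>X \<epsilon>\<close> with
  initial state \<open>\<xi>(\<epsilon>)\<close> and forcing amplitude \<open>A(\<epsilon>)\<close>, where \<open>\<xi>(\<epsilon>)\<close>, \<open>l T(\<epsilon>)\<close> and \<open>A(\<epsilon>)\<close> are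
  \<open>O(\<epsilon>)\<close>-close to \<open>x0(s)\<close>, \<open>\<tau>\<close> and \<open>e\<close>.
\<close>

definition perturbed_orbit_family ::
  "(real^'n) set \<Rightarrow> (real^'n \<Rightarrow> real^'n^'n) \<Rightarrow> (real^'n \<Rightarrow> real) \<Rightarrow> 'n perturbation \<Rightarrow>
   nat \<Rightarrow> real \<Rightarrow> (real \<Rightarrow> 'n state) \<Rightarrow> real \<Rightarrow> real \<Rightarrow>
   (real \<Rightarrow> 'n state) \<Rightarrow> (real \<Rightarrow> real) \<Rightarrow> (real \<Rightarrow> real) \<Rightarrow> (real \<Rightarrow> real \<Rightarrow> 'n state) \<Rightarrow> bool" where
  "perturbed_orbit_family U M V Q l \<tau> x0 s e \<xi> T A X \<longleftrightarrow>
     (\<forall>\<^sub>F \<epsilon> in at_right 0.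
        T \<epsilon> > 0 \<and>
        perturbed_trajectory U M V Q (T \<epsilon>) (A \<epsilon>) \<epsilon> (\<xi> \<epsilon>) (X \<epsilon>) \<and>
        (\<forall>t. X \<epsilon> (t + real l * T \<epsilon>) = X \<epsilon> t)) \<and>
     (\<lambda>\<epsilon>. norm (\<xi> \<epsilon> - x0 s)) \<in> O[at_right 0](\<lambda>\<epsilon>. \<epsilon>) \<and>
     (\<lambda>\<epsilon>. real l * T \<epsilon> - \<tau>) \<in> O[at_right 0](\<lambda>\<epsilon>. \<epsilon>) \<and>
     (\<lambda>\<epsilon>. A \<epsilon> - e) \<in> O[at_right 0](\<lambda>\<epsilon>. \<epsilon>)"


section \<open>Harmonics and their phase\<close>

text \<open>The \<open>l\<close>-th term of the Fourier series of a \<open>P\<close>-periodic function.\<close>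

definition harmonic :: "nat \<Rightarrow> real \<Rightarrow> (real \<Rightarrow> real) \<Rightarrow> real \<Rightarrow> real" where
  "harmonic l P h t =
     2 / P * integral {0..P} (\<lambda>u. h u * cos (2 * real l * pi / P * u)) * cos (2 * real l * pi / P * t) +
     2 / P * integral {0..P} (\<lambda>u. h u * sin (2 * real l * pi / P * u)) * sin (2 * real l * pi / P * t)"

text \<open>Phase, in radians, of a signal relative to the forcing signal \<open>cos (2 \<pi> t / T)\<close>.\<close>

definition has_phase_lag :: "(real \<Rightarrow> real) \<Rightarrow> real \<Rightarrow> real \<Rightarrow> bool" where
  "has_phase_lag h T \<phi> \<longleftrightarrow> (\<exists>c>0. \<forall>t. h t = c * cos (2 * pi / T * t - \<phi>))"

definition has_phase_lead :: "(real \<Rightarrow> real) \<Rightarrow> real \<Rightarrow> real \<Rightarrow> bool" where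
  "has_phase_lead h T \<phi> \<longleftrightarrow> (\<exists>c>0. \<forall>t. h t = c * cos (2 * pi / T * t + \<phi>))"

end

theory Submission
  imports Defs
begin

text \<open>
  Why the phase is a right angle. Let \<open>h\<close> be the coordinate \<open>\<langle>q\<^sub>0(\<cdot> + s), f\<^sub>e\<rangle>\<close> of the conservative
  motion and \<open>k = 2 l \<pi> / \<tau>\<close>. The dissipative part of the Melnikov integral does not depend on the
  shift \<open>\<sigma>\<close>, because it is an integral of a \<open>\<tau>\<close>-periodic function over a period: it equals the
  resistance \<open>R\<close>. The forcing part is \<open>e\<close> times the \<open>l\<close>-th cosine coefficient of the velocity along
  \<open>f\<^sub>e\<close>, shifted by \<open>\<sigma>\<close>, hence a pure oscillation \<open>e (a cos k\<sigma> + b sin k\<sigma>)\<close>. At a quadratic zero this oscillation equals \<open>R\<close>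
  and its \<open>\<sigma>\<close>-derivative vanishes. Seen from the shifted time origin \<open>s\<close>, the vanishing derivative says
  that the velocity has no sine coefficient, and the value says that its unnormalised cosine coefficient is \<open>R / e\<close>
  (here \<open>e\<close> is nonzero, since \<open>e R\<close> is).
  Integration by parts turns the velocity into the coordinate and exchanges sine and cosine: \<open>h\<close> has no
  cosine coefficient, and its sine coefficient has the sign of \<open>e R\<close>. So the \<open>l\<close>-th harmonic of \<open>h\<close> is
  \<open>\<plusminus> c sin kt\<close>, a quarter period away from \<open>cos kt\<close>
  (lemma \<open>melnikov_quadratic_zero_quadrature\<close>).

  The rest is stability of this picture under the perturbation. A Gronwall estimate in a compact tube
  around the conservative orbit shows that the perturbed motion stays \<open>O(\<epsilon>)\<close>-close to
  \<open>x\<^sub>0(\<cdot> + s)\<close> over a whole period (lemma \<open>perturbed_solutions_close\<close>). Since the period also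
  moves by \<open>O(\<epsilon>)\<close> only, so do the two Fourier coefficients, once both are rescaled to the
  unit interval (lemma \<open>fourier_coefficient_close\<close>). The cosine coefficient is then \<open>O(\<epsilon>)\<close> while the
  sine coefficient stays away from \<open>0\<close>, and the deviation of the phase from \<open>\<pi>/2\<close> is the arc tangent of
  their quotient (lemma \<open>quadrature_asymptotics\<close>).
\<close>

section \<open>Lipschitz bounds from continuous partial derivatives\<close>

text \<open>
  The mean value inequality is applied to one coordinate at a time. Every intermediate point differs
  from \<open>x\<close> by a vector whose coordinates are bounded by those of \<open>y - x\<close>, so that the path from
  \<open>x\<close> to \<open>y\<close> does not leave the Euclidean ball.
\<close>
lemma norm_diff_le_of_partials:
  fixes F :: "'a::euclidean_space \<Rightarrow> 'b::real_normed_vector"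
  assumes ball: "cball x d \<subseteq> S"
    and der: "\<And>b z. b \<in> Basis \<Longrightarrow> z \<in> S \<Longrightarrow>
           ((\<lambda>h. F (z + h *\<^sub>R b)) has_vector_derivative D b z) (at 0 within {h. z + h *\<^sub>R b \<in> S})"
    and bnd: "\<And>b z. b \<in> Basis \<Longrightarrow> z \<in> cball x d \<Longrightarrow> norm (D b z) \<le> B"
    and y: "y \<in> cball x d"
  shows "norm (F y - F x) \<le> real DIM('a) * B * norm (y - x)"
proof -
  define c where "c b = (y - x) \<bullet> b" for b
  define P where "P A = x + (\<Sum>b\<in>A. c b *\<^sub>R b)" for A
  have "norm (F (P A) - F x) \<le> real (card A) * B * norm (y - x)" if "finite A" "A \<subseteq> Basis" for A
    using that
  proof (induction A rule: finite_induct)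
    case empty
    then show ?case by (simp add: P_def)
  next
    case (insert b A)
    then have b: "b \<in> Basis" and A: "A \<subseteq> Basis" by auto
    define \<phi> where "\<phi> h = F (P A + h *\<^sub>R b)" for h
    have in_ball: "P A + h *\<^sub>R b \<in> cball x d" if h: "h \<in> closed_segment 0 (c b)" for h
    proof -
      have "norm ((\<Sum>b\<in>A. c b *\<^sub>R b) + h *\<^sub>R b) \<le> norm (y - x)"
      proof (rule norm_le_componentwise)
        fix i :: 'a assume i: "i \<in> Basis"
        have "(\<Sum>b\<in>A. c b *\<^sub>R b) \<bullet> i = (\<Sum>b\<in>A. if b = i then c b else 0)"
          unfolding inner_sum_left using i A by (intro sum.cong) (auto simp: inner_Basis)
        also have "\<dots> = (if i \<in> A then c i else 0)"
          using insert.hyps(1) by simp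
        finally have "((\<Sum>b\<in>A. c b *\<^sub>R b) + h *\<^sub>R b) \<bullet> i =
            (if i \<in> A then c i else 0) + (if i = b then h else 0)"
          using i b by (auto simp: inner_add_left inner_Basis)
        moreover have "\<bar>h\<bar> \<le> \<bar>c b\<bar>"
          using h by (auto simp: closed_segment_eq_real_ivl split: if_splits)
        ultimately show "\<bar>((\<Sum>b\<in>A. c b *\<^sub>R b) + h *\<^sub>R b) \<bullet> i\<bar> \<le> \<bar>(y - x) \<bullet> i\<bar>"
          using insert.hyps(2) by (auto simp: c_def)
      qed
      also have "\<dots> \<le> d" using y by (simp add: dist_norm norm_minus_commute)
      finally have "dist x (x + ((\<Sum>b\<in>A. c b *\<^sub>R b) + h *\<^sub>R b)) \<le> d"
        by (simp only: dist_norm norm_minus_commute[of x] add_diff_cancel_left')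
      then show ?thesis by (simp add: P_def add.assoc)
    qed
    have der\<phi>: "(\<phi> has_derivative (\<lambda>k. k *\<^sub>R D b (P A + h *\<^sub>R b))) (at h within closed_segment 0 (c b))"
      if h: "h \<in> closed_segment 0 (c b)" for h
    proof -
      define z where "z = P A + h *\<^sub>R b"
      have z: "z \<in> S" using in_ball[OF h] ball by (auto simp: z_def)
      have "(\<lambda>k. k - h) ` closed_segment 0 (c b) \<subseteq> {k. z + k *\<^sub>R b \<in> S}"
        using in_ball ball by (fastforce simp: z_def algebra_simps)
      then have "((\<lambda>k. F (z + k *\<^sub>R b)) has_vector_derivative D b z)
          (at (h - h) within (\<lambda>k. k - h) ` closed_segment 0 (c b))"
        using has_vector_derivative_within_subset[OF der[OF b z]] by simp
      moreover have "((\<lambda>k. k - h) has_vector_derivative 1) (at h within closed_segment 0 (c b))"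
        by (auto intro!: derivative_eq_intros)
      ultimately have "((\<lambda>k. F (z + k *\<^sub>R b)) \<circ> (\<lambda>k. k - h) has_vector_derivative 1 *\<^sub>R D b z)
          (at h within closed_segment 0 (c b))"
        by (intro vector_diff_chain_within)
      moreover have "(\<lambda>k. F (z + k *\<^sub>R b)) \<circ> (\<lambda>k. k - h) = \<phi>"
        by (auto simp: \<phi>_def z_def fun_eq_iff algebra_simps)
      ultimately show ?thesis by (simp add: has_vector_derivative_def z_def)
    qed
    have "norm (\<phi> (c b) - \<phi> 0) \<le> B * norm (c b - 0)"
    proof (rule differentiable_bound[OF _ der\<phi>])
      fix h assume h: "h \<in> closed_segment 0 (c b)"
      show "onorm (\<lambda>k. k *\<^sub>R D b (P A + h *\<^sub>R b)) \<le> B"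
        using bnd[OF b in_ball[OF h]]
        by (intro onorm_le) (simp add: mult.commute[of B] mult_left_mono)
    qed auto
    also have "\<dots> \<le> B * norm (y - x)"
    proof (rule mult_left_mono)
      show "norm (c b - 0) \<le> norm (y - x)"
        using Basis_le_norm[OF b, of "y - x"] by (simp add: c_def)
      have "x \<in> cball x d" using y by (auto intro: order_trans[OF zero_le_dist])
      then show "0 \<le> B" using bnd[OF b] norm_ge_zero order_trans by blast
    qed
    finally have "norm (\<phi> (c b) - \<phi> 0) \<le> B * norm (y - x)" .
    moreover have "\<phi> (c b) = F (P (insert b A))" "\<phi> 0 = F (P A)"
      using insert.hyps by (simp_all add: \<phi>_def P_def algebra_simps)
    moreover have "norm (F (P A) - F x) \<le> real (card A) * B * norm (y - x)"
      using insert.IH A by simp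
    ultimately have "norm (F (P (insert b A)) - F x) \<le> B * norm (y - x) + real (card A) * B * norm (y - x)"
      using norm_diff_triangle_le by metis
    then show ?case using insert.hyps by (simp add: algebra_simps)
  qed
  from this[of Basis] show ?thesis
    by (simp add: P_def c_def euclidean_representation)
qed

lemma Ck_along_imp_continuous_on: "Ck_along D k S F \<Longrightarrow> continuous_on S F"
  by (cases k) auto

text \<open>
  A closed tube around \<open>K\<close> is compact and still inside \<open>S\<close>, so the partial derivatives are bounded on
  it. A point within distance \<open>d\<close> of a point of \<open>K\<close> lies in a ball around it that is contained in the
  tube, and there the coordinatewise estimate applies.
\<close>
lemma C1_lipschitz_near_compact:
  fixes F :: "'a::euclidean_space \<Rightarrow> 'b::real_normed_vector"
  assumes F: "Ck (Suc m) S F" and S: "open S" and K: "compact K" "K \<noteq> {}" "K \<subseteq> S"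
  obtains d L N where "d > 0" "L \<ge> 0" "compact N" "N \<subseteq> S"
    "\<And>x y. x \<in> K \<Longrightarrow> norm (y - x) \<le> d \<Longrightarrow> y \<in> N \<and> norm (F y - F x) \<le> L * norm (y - x)"
proof -
  obtain d where d: "d > 0" and dS: "{x. infdist x K \<le> d} \<subseteq> S"
    using compact_in_open_separated[OF K(2,1) S K(3)] by metis
  define N where "N = {x. infdist x K \<le> d}"
  have N: "compact N" unfolding N_def by (rule compact_infdist_le[OF K(2,1) d])
  obtain D where D: "\<And>b z. b \<in> Basis \<Longrightarrow> z \<in> S \<Longrightarrow>
           ((\<lambda>h. F (z + h *\<^sub>R b)) has_vector_derivative D b z) (at 0 within {h. z + h *\<^sub>R b \<in> S})"
      and contD: "\<And>b. b \<in> Basis \<Longrightarrow> continuous_on S (D b)"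
  proof -
    have "\<forall>b\<in>Basis. \<exists>F'. (\<forall>x\<in>S. ((\<lambda>h. F (x + h *\<^sub>R b)) has_vector_derivative F' x)
        (at 0 within {h. x + h *\<^sub>R b \<in> S})) \<and> continuous_on S F'"
    proof
      fix b :: 'a assume "b \<in> Basis"
      then obtain F' where "\<forall>x\<in>S. ((\<lambda>h. F (x + h *\<^sub>R b)) has_vector_derivative F' x)
        (at 0 within {h. x + h *\<^sub>R b \<in> S})" "Ck m S F'"
        using F unfolding Ck_along.simps by blast
      then show "\<exists>F'. (\<forall>x\<in>S. ((\<lambda>h. F (x + h *\<^sub>R b)) has_vector_derivative F' x)
        (at 0 within {h. x + h *\<^sub>R b \<in> S})) \<and> continuous_on S F'"
        using Ck_along_imp_continuous_on by blast
    qed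
    then have "\<exists>D. \<forall>b\<in>Basis. (\<forall>x\<in>S. ((\<lambda>h. F (x + h *\<^sub>R b)) has_vector_derivative D b x)
        (at 0 within {h. x + h *\<^sub>R b \<in> S})) \<and> continuous_on S (D b)"
      by (rule bchoice)
    then show thesis using that by blast
  qed
  have "\<exists>B. \<forall>z\<in>N. norm (D b z) \<le> B" if "b \<in> Basis" for b
  proof -
    have "compact (D b ` N)"
      using dS by (intro compact_continuous_image[OF continuous_on_subset[OF contD[OF that]] N]) (simp add: N_def)
    then have "bounded (D b ` N)" by (rule compact_imp_bounded)
    then show ?thesis by (auto simp: bounded_iff)
  qed
  then have "\<forall>b\<in>Basis. \<exists>B. \<forall>z\<in>N. norm (D b z) \<le> B" by blast
  from bchoice[OF this] obtain B
    where B: "norm (D b z) \<le> B b" if "b \<in> Basis" "z \<in> N" for b z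
    by blast
  define B' where "B' = Max (insert 0 (B ` Basis))"
  have B': "norm (D b z) \<le> B'" if "b \<in> Basis" "z \<in> N" for b z
    using that(1) unfolding B'_def by (intro order_trans[OF B[OF that] Max_ge]) auto
  have B'0: "B' \<ge> 0" unfolding B'_def by simp
  have ball: "cball x d \<subseteq> N" if "x \<in> K" for x
  proof
    fix y assume "y \<in> cball x d"
    then show "y \<in> N" using infdist_le[OF that, of y] by (simp add: N_def dist_commute)
  qed
  show thesis
  proof
    show "0 < d" "compact N" "N \<subseteq> S" "0 \<le> real DIM('a) * B'"
      using d N dS B'0 by (auto simp: N_def)
    fix x y assume x: "x \<in> K" and "norm (y - x) \<le> d"
    then have y: "y \<in> cball x d" by (simp add: dist_norm norm_minus_commute)
    have "norm (F y - F x) \<le> real DIM('a) * B' * norm (y - x)"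
      using ball[OF x] dS B' by (intro norm_diff_le_of_partials[OF _ D _ y]) (auto simp: N_def)
    then show "y \<in> N \<and> norm (F y - F x) \<le> real DIM('a) * B' * norm (y - x)"
      using y ball[OF x] by auto
  qed
qed

section \<open>Perturbed solutions stay close on bounded times\<close>

text \<open>
  As long as the difference \<open>y\<close> of the two solutions stays in the tube of radius \<open>d\<close>, the function
  \<open>(|y|\<^sup>2 + k\<^sup>2) exp (- 2 (L + 1) t)\<close> decreases, which is Gronwall's inequality in differential form; the
  summand \<open>k\<^sup>2\<close> absorbs the perturbation through \<open>2 k |y| \<le> |y|\<^sup>2 + k\<^sup>2\<close>. The resulting bound is
  smaller than \<open>d\<close>, so there is no first time at which the boundary of the tube is reached.
\<close>
lemma gronwall_in_tube:
  fixes x z :: "real \<Rightarrow> 'a::real_inner"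
  assumes dz: "\<And>t. t \<in> {0..H} \<Longrightarrow> (z has_vector_derivative f (z t)) (at t)"
    and dx: "\<And>t. t \<in> {0..H} \<Longrightarrow> (x has_vector_derivative f (x t) + w t) (at t)"
    and lip: "\<And>t y. t \<in> {0..H} \<Longrightarrow> norm (y - z t) \<le> d \<Longrightarrow> norm (f y - f (z t)) \<le> L * norm (y - z t)"
    and w: "\<And>t. t \<in> {0..H} \<Longrightarrow> norm (x t - z t) \<le> d \<Longrightarrow> norm (w t) \<le> k"
    and k: "k \<ge> 0" and L: "L \<ge> 0"
    and small: "(norm (x 0 - z 0) + k) * exp ((L + 1) * H) < d"
    and t: "t \<in> {0..H}"
  shows "norm (x t - z t) \<le> (norm (x 0 - z 0) + k) * exp ((L + 1) * H)"
proof -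
  define y where "y t = x t - z t" for t
  define E where "E = (norm (y 0) + k) * exp ((L + 1) * H)"
  have dy: "(y has_vector_derivative f (x t) + w t - f (z t)) (at t)" if "t \<in> {0..H}" for t
    unfolding y_def[abs_def] using dx[OF that] dz[OF that] by (rule has_vector_derivative_diff)
  have E_bound: "norm (y t) \<le> E" if t: "t \<in> {0..H}" and in_tube: "\<And>\<sigma>. \<sigma> \<in> {0..t} \<Longrightarrow> norm (y \<sigma>) \<le> d" for t
  proof -
    define u where "u \<sigma> = (y \<sigma> \<bullet> y \<sigma> + k\<^sup>2) * exp (- (2 * (L + 1) * \<sigma>))" for \<sigma>
    have "u t \<le> u 0"
    proof (rule DERIV_nonpos_imp_nonincreasing[of 0 t u])
      show "0 \<le> t" using t by simp
      fix \<sigma> assume "0 \<le> \<sigma>" "\<sigma> \<le> t"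
      then have \<sigma>: "\<sigma> \<in> {0..H}" "\<sigma> \<in> {0..t}" using t by auto
      \<comment> \<open>This is the derivative of the difference of the two solutions.\<close>
      define v where "v = f (x \<sigma>) + w \<sigma> - f (z \<sigma>)"
      have "((\<lambda>\<sigma>. y \<sigma> \<bullet> y \<sigma>) has_real_derivative 2 * (y \<sigma> \<bullet> v)) (at \<sigma>)"
        unfolding has_real_derivative_iff_has_vector_derivative has_vector_derivative_def
        using dy[OF \<sigma>(1)] unfolding has_vector_derivative_def v_def[symmetric]
        by (auto intro!: derivative_eq_intros simp: inner_commute algebra_simps)
      then have du: "(u has_real_derivative
          (2 * (y \<sigma> \<bullet> v) - 2 * (L + 1) * (y \<sigma> \<bullet> y \<sigma> + k\<^sup>2)) * exp (- (2 * (L + 1) * \<sigma>))) (at \<sigma>)"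
        unfolding u_def[abs_def] by (auto intro!: derivative_eq_intros simp: algebra_simps)
      have "norm (y \<sigma>) \<le> d" using in_tube \<sigma> by auto
      then have "norm (f (x \<sigma>) - f (z \<sigma>)) \<le> L * norm (y \<sigma>)" "norm (w \<sigma>) \<le> k"
        using lip[OF \<sigma>(1), of "x \<sigma>"] w[OF \<sigma>(1)] by (auto simp: y_def)
      then have "norm (f (x \<sigma>) - f (z \<sigma>) + w \<sigma>) \<le> L * norm (y \<sigma>) + k"
        by (intro norm_triangle_le add_mono)
      then have "norm v \<le> L * norm (y \<sigma>) + k"
        by (simp add: v_def algebra_simps)
      then have "y \<sigma> \<bullet> v \<le> norm (y \<sigma>) * (L * norm (y \<sigma>) + k)"
        by (rule order_trans[OF norm_cauchy_schwarz mult_left_mono]) simp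
      moreover have "2 * (norm (y \<sigma>) * k) \<le> (norm (y \<sigma>))\<^sup>2 + k\<^sup>2"
        using sum_squares_bound[of "norm (y \<sigma>)" k] by (simp add: mult.assoc)
      moreover have "0 \<le> L * k\<^sup>2" "0 \<le> k\<^sup>2" "0 \<le> (norm (y \<sigma>))\<^sup>2" using L by auto
      moreover have "norm (y \<sigma>) * (L * norm (y \<sigma>) + k) = L * (norm (y \<sigma>))\<^sup>2 + norm (y \<sigma>) * k"
        "2 * (L + 1) * (y \<sigma> \<bullet> y \<sigma> + k\<^sup>2) =
          2 * (L * (norm (y \<sigma>))\<^sup>2) + 2 * (L * k\<^sup>2) + 2 * (norm (y \<sigma>))\<^sup>2 + 2 * k\<^sup>2"
        unfolding power2_norm_eq_inner by (simp_all add: algebra_simps power2_eq_square flip: power2_norm_eq_inner)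
      ultimately have "2 * (y \<sigma> \<bullet> v) - 2 * (L + 1) * (y \<sigma> \<bullet> y \<sigma> + k\<^sup>2) \<le> 0"
        by linarith
      then show "\<exists>u'. (u has_real_derivative u') (at \<sigma>) \<and> u' \<le> 0"
        using du by (intro exI conjI) (auto intro: mult_nonpos_nonneg)
    qed
    then have "(y t \<bullet> y t + k\<^sup>2) * exp (- (2 * (L + 1) * t)) \<le> y 0 \<bullet> y 0 + k\<^sup>2"
      by (simp add: u_def)
    then have "y t \<bullet> y t + k\<^sup>2 \<le> (y 0 \<bullet> y 0 + k\<^sup>2) * exp (2 * (L + 1) * t)"
      unfolding exp_minus by (simp only: divide_inverse[symmetric] pos_divide_le_eq[OF exp_gt_zero])
    also have "\<dots> \<le> (norm (y 0) + k)\<^sup>2 * exp (2 * (L + 1) * H)"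
    proof (rule mult_mono)
      show "y 0 \<bullet> y 0 + k\<^sup>2 \<le> (norm (y 0) + k)\<^sup>2"
        using k by (simp add: power2_sum power2_norm_eq_inner)
      show "exp (2 * (L + 1) * t) \<le> exp (2 * (L + 1) * H)"
        using L t by (simp add: mult_left_mono)
    qed auto
    also have "\<dots> = E\<^sup>2"
      unfolding E_def power_mult_distrib exp_double[symmetric] mult.assoc ..
    finally have "(norm (y t))\<^sup>2 \<le> E\<^sup>2"
      using zero_le_power2[of k] unfolding power2_norm_eq_inner by linarith
    then show ?thesis by (rule power2_le_imp_le) (use k in \<open>simp add: E_def\<close>)
  qed
  have Ed: "E < d" using small by (simp add: E_def y_def)
  have conty: "continuous_on {0..H} (\<lambda>t. norm (y t))"
    using dy by (intro continuous_on_norm continuous_at_imp_continuous_on ballI has_vector_derivative_continuous)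
  have tube: "norm (y t) < d" if "t \<in> {0..H}" for t
  proof (rule ccontr)
    \<comment> \<open>Otherwise there is a first time \<open>t1\<close> outside the open tube; up to it the estimate applies.\<close>
    define Z where "Z = {0..H} \<inter> (\<lambda>t. norm (y t)) -` {d..}"
    assume "\<not> norm (y t) < d"
    then have "Z \<noteq> {}" using that by (auto simp: Z_def)
    moreover have "compact Z"
    proof -
      have "closed Z" unfolding Z_def by (intro continuous_closed_preimage conty) auto
      then show ?thesis unfolding compact_eq_bounded_closed
        using bounded_subset[OF bounded_closed_interval, of Z 0 H] by (auto simp: Z_def)
    qed
    ultimately obtain t1 where t1: "t1 \<in> Z" and first: "\<And>\<sigma>. \<sigma> \<in> Z \<Longrightarrow> t1 \<le> \<sigma>"
      using compact_attains_inf[of Z] by blast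
    have before: "norm (y \<sigma>) \<le> d" if "\<sigma> \<in> {0..<t1}" for \<sigma>
      using first[of \<sigma>] that t1 by (force simp: Z_def)
    \<comment> \<open>The bound passes to the limit from the left, unless \<open>t1\<close> is the initial time.\<close>
    moreover have "norm (y t1) \<le> d"
    proof (cases "t1 = 0")
      case True
      have "norm (y 0) * 1 \<le> E" using k L t unfolding E_def by (intro mult_mono) auto
      then show ?thesis using True Ed by simp
    next
      case False
      have "((\<lambda>t. norm (y t)) \<longlongrightarrow> norm (y t1)) (at t1 within {0..<t1})"
        by (rule tendsto_within_subset[OF conty[unfolded continuous_on, rule_format]])
          (use t1 in \<open>auto simp: Z_def\<close>)
      moreover have "at t1 within {0..<t1} \<noteq> bot"
        using False t1 by (simp add: Z_def trivial_limit_within islimpt_Ico)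
      ultimately show ?thesis
        using before by (intro tendsto_upperbound) (auto simp: eventually_at_filter)
    qed
    ultimately have "norm (y \<sigma>) \<le> d" if "\<sigma> \<in> {0..t1}" for \<sigma>
      using that by (cases "\<sigma> = t1") auto
    then have "norm (y t1) \<le> E"
      using t1 by (intro E_bound) (simp_all add: Z_def)
    then show False using t1 Ed by (simp add: Z_def)
  qed
  show ?thesis
    using E_bound[OF t] tube t unfolding E_def y_def by (force intro: less_imp_le)
qed

text \<open>
  Over the fixed time span \<open>{0..H}\<close> the conservative solution sweeps out a compact arc. In the tube around
  it the perturbing field is bounded uniformly in all its arguments, since the parameters converge to
  limits inside the domain. Hence the perturbation and the initial distance are both \<open>O(\<epsilon>)\<close>, and
  Gronwall's inequality preserves this order.
\<close>
lemma perturbed_solutions_close: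
  fixes f :: "'a::euclidean_space \<Rightarrow> 'a" and g :: "'a \<times> real \<times> real \<times> real \<times> real \<Rightarrow> 'a"
    and T A :: "real \<Rightarrow> real"
  assumes S: "open S" and f: "Ck (Suc m) S f"
    and g: "continuous_on (S \<times> UNIV \<times> {0<..} \<times> UNIV \<times> {0..<\<epsilon>0}) g" and \<epsilon>0: "\<epsilon>0 > 0"
    and x0: "\<And>t. x0 t \<in> S" "\<And>t. (x0 has_vector_derivative f (x0 t)) (at t)"
    and X: "\<forall>\<^sub>F \<epsilon> in at_right 0. \<forall>t.
        (X \<epsilon> has_vector_derivative f (X \<epsilon> t) + \<epsilon> *\<^sub>R g (X \<epsilon> t, t, T \<epsilon>, A \<epsilon>, \<epsilon>)) (at t)"
    and T: "(T \<longlongrightarrow> T0) (at_right 0)" "T0 > 0" and A: "(A \<longlongrightarrow> e) (at_right 0)"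
    and init: "\<forall>\<^sub>F \<epsilon> in at_right 0. norm (X \<epsilon> 0 - x0 s) \<le> c * \<epsilon>" and c: "c \<ge> 0"
    and H: "H \<ge> 0"
  obtains K where "K \<ge> 0"
    "\<forall>\<^sub>F \<epsilon> in at_right 0. \<forall>t\<in>{0..H}. norm (X \<epsilon> t - x0 (t + s)) \<le> K * \<epsilon>"
proof -
  define z where "z t = x0 (t + s)" for t
  have dz: "(z has_vector_derivative f (z t)) (at t)" for t
  proof -
    have "((\<lambda>t. t + s) has_vector_derivative 1) (at t)" by (auto intro!: derivative_eq_intros)
    from vector_diff_chain_at[OF this x0(2)] show ?thesis by (simp add: z_def[abs_def] comp_def)
  qed
  have contz: "continuous_on {0..H} z"
    using dz by (intro continuous_at_imp_continuous_on ballI has_vector_derivative_continuous)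
  have orbit: "compact (z ` {0..H})" "z ` {0..H} \<noteq> {}" "z ` {0..H} \<subseteq> S"
    using H x0(1) compact_continuous_image[OF contz compact_Icc] by (auto simp: z_def)
  obtain d L N where d: "d > 0" and L: "L \<ge> 0" and N: "compact N" "N \<subseteq> S"
    and tube: "\<And>x y. x \<in> z ` {0..H} \<Longrightarrow> norm (y - x) \<le> d \<Longrightarrow> y \<in> N \<and> norm (f y - f x) \<le> L * norm (y - x)"
    using C1_lipschitz_near_compact[OF f S orbit] by metis
  define D where "D = N \<times> {0..H} \<times> {T0 / 2..2 * T0} \<times> {e - 1..e + 1} \<times> {0..\<epsilon>0 / 2}"
  have "compact D" unfolding D_def by (intro compact_Times N(1) compact_Icc)
  moreover have "continuous_on D g"
    using N(2) T(2) \<epsilon>0 by (intro continuous_on_subset[OF g]) (auto simp: D_def)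
  ultimately have "bounded (g ` D)" by (intro compact_imp_bounded compact_continuous_image)
  then obtain G where G: "G > 0" "\<And>y. y \<in> D \<Longrightarrow> norm (g y) \<le> G"
    unfolding bounded_pos by auto
  define E where "E = exp ((L + 1) * H)"
  have "\<forall>\<^sub>F \<epsilon> in at_right (0::real). \<epsilon> \<in> {0<..<min (\<epsilon>0 / 2) (d / ((c + G) * E))}"
    using \<epsilon>0 d c G(1) by (intro eventually_at_right_real) (simp add: E_def add_nonneg_pos)
  moreover have "\<forall>\<^sub>F \<epsilon> in at_right 0. T0 / 2 < T \<epsilon>" "\<forall>\<^sub>F \<epsilon> in at_right 0. T \<epsilon> < 2 * T0"
    using order_tendstoD(1)[OF T(1), of "T0 / 2"] order_tendstoD(2)[OF T(1), of "2 * T0"] T(2) by simp_all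
  moreover have "\<forall>\<^sub>F \<epsilon> in at_right 0. e - 1 < A \<epsilon>" "\<forall>\<^sub>F \<epsilon> in at_right 0. A \<epsilon> < e + 1"
    using order_tendstoD(1)[OF A, of "e - 1"] order_tendstoD(2)[OF A, of "e + 1"] by simp_all
  ultimately have "\<forall>\<^sub>F \<epsilon> in at_right 0. \<forall>t\<in>{0..H}. norm (X \<epsilon> t - x0 (t + s)) \<le> (c + G) * E * \<epsilon>"
    using X init
  proof eventually_elim
    case (elim \<epsilon>)
    then have \<epsilon>: "\<epsilon> > 0" "\<epsilon> \<le> \<epsilon>0 / 2" and \<epsilon>d: "\<epsilon> < d / ((c + G) * E)" by auto
    have start: "(norm (X \<epsilon> 0 - z 0) + \<epsilon> * G) * E \<le> (c + G) * E * \<epsilon>"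
      using elim by (simp add: z_def E_def algebra_simps)
    show ?case
    proof
      fix t assume t: "t \<in> {0..H}"
      have "norm (X \<epsilon> t - z t) \<le> (norm (X \<epsilon> 0 - z 0) + \<epsilon> * G) * exp ((L + 1) * H)"
      proof (rule gronwall_in_tube[OF dz _ _ _ _ L _ t])
        show "(X \<epsilon> has_vector_derivative f (X \<epsilon> t) + \<epsilon> *\<^sub>R g (X \<epsilon> t, t, T \<epsilon>, A \<epsilon>, \<epsilon>)) (at t)" for t
          using elim by blast
        show "norm (f y - f (z t)) \<le> L * norm (y - z t)" if "t \<in> {0..H}" "norm (y - z t) \<le> d" for t y
          using tube that by blast
        show "norm (\<epsilon> *\<^sub>R g (X \<epsilon> t, t, T \<epsilon>, A \<epsilon>, \<epsilon>)) \<le> \<epsilon> * G"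
          if "t \<in> {0..H}" "norm (X \<epsilon> t - z t) \<le> d" for t
        proof -
          have "X \<epsilon> t \<in> N" using tube that by blast
          then have "(X \<epsilon> t, t, T \<epsilon>, A \<epsilon>, \<epsilon>) \<in> D" using that elim \<epsilon> by (auto simp: D_def)
          then show ?thesis using G(2) \<epsilon> by simp
        qed
        show "0 \<le> \<epsilon> * G" using \<epsilon> G by simp
        have "(c + G) * E > 0" using c G(1) by (simp add: E_def)
        from pos_less_divide_eq[OF this, THEN iffD1, OF \<epsilon>d] have "(c + G) * E * \<epsilon> < d"
          by (simp only: mult.commute)
        with start show "(norm (X \<epsilon> 0 - z 0) + \<epsilon> * G) * exp ((L + 1) * H) < d"
          unfolding E_def by linarith
      qed
      with start show "norm (X \<epsilon> t - x0 (t + s)) \<le> (c + G) * E * \<epsilon>"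
        unfolding E_def z_def by linarith
    qed
  qed
  then show thesis using c G(1) by (intro that[of "(c + G) * E"]) (simp_all add: E_def)
qed

section \<open>Fourier coefficients\<close>

lemma integral_rescale_to_unit:
  fixes F :: "real \<Rightarrow> real"
  assumes F: "F integrable_on {0..P}" and P: "P > 0"
  shows "integral {0..1} (\<lambda>v. F (P * v)) = integral {0..P} F / P"
proof -
  have img: "(\<lambda>x. x / P) ` {0..P} = {0..1}"
    using P image_divide_atLeastAtMost[of P 0 P] by simp
  show ?thesis
    using has_integral_stretch_real[OF integrable_integral[OF F], of P] P unfolding img
    by (simp add: integral_unique)
qed

text \<open>
  In terms of an antiderivative \<open>G\<close> of \<open>F\<close>, the left-hand side is \<open>G(s + \<tau>) - G(s)\<close>. Its derivative in
  \<open>s\<close> is \<open>F(s + \<tau>) - F(s) = 0\<close>.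
\<close>
lemma integral_shift_periodic:
  fixes F :: "real \<Rightarrow> real"
  assumes cont: "continuous_on UNIV F" and per: "\<And>t. F (t + \<tau>) = F t" and \<tau>: "\<tau> > 0"
  shows "integral {0..\<tau>} (\<lambda>t. F (t + s)) = integral {0..\<tau>} F"
proof -
  define a b where "a = - \<bar>s\<bar> - 1" and "b = \<bar>s\<bar> + \<tau> + 1"
  obtain G where G: "\<And>x. x \<in> {a..b} \<Longrightarrow> (G has_vector_derivative F x) (at x within {a..b})"
    using antiderivative_continuous[OF continuous_on_subset[OF cont subset_UNIV]] by metis
  have G': "(G has_real_derivative F x) (at x)" if "a < x" "x < b" for x
    using G[of x] that by (simp add: has_real_derivative_iff_has_vector_derivative at_within_Icc_at)
  have G\<tau>: "((\<lambda>t. G (t + \<sigma>)) has_real_derivative F (t + \<sigma>)) (at t)" if "a < t + \<sigma>" "t + \<sigma> < b" for t \<sigma>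
    using G'[OF that] by (subst (asm) DERIV_shift)
  have FTC: "integral {0..\<tau>} (\<lambda>t. F (t + \<sigma>)) = G (\<sigma> + \<tau>) - G \<sigma>" if "\<bar>\<sigma>\<bar> \<le> \<bar>s\<bar>" for \<sigma>
  proof -
    have "((\<lambda>t. F (t + \<sigma>)) has_integral (G (\<tau> + \<sigma>) - G (0 + \<sigma>))) {0..\<tau>}"
    proof (rule fundamental_theorem_of_calculus)
      fix t assume t: "t \<in> {0..\<tau>}"
      then have "((\<lambda>t. G (t + \<sigma>)) has_real_derivative F (t + \<sigma>)) (at t)"
        using that by (intro G\<tau>) (auto simp: a_def b_def)
      then show "((\<lambda>t. G (t + \<sigma>)) has_vector_derivative F (t + \<sigma>)) (at t within {0..\<tau>})"
        by (simp add: has_real_derivative_iff_has_vector_derivative has_vector_derivative_at_within)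
    qed (use \<tau> in simp)
    then show ?thesis by (simp add: integral_unique add.commute)
  qed
  have "\<exists>c. \<forall>\<sigma>\<in>{- \<bar>s\<bar>..\<bar>s\<bar>}. G (\<sigma> + \<tau>) - G \<sigma> = c"
  proof (rule has_field_derivative_zero_constant)
    fix \<sigma> assume \<sigma>: "\<sigma> \<in> {- \<bar>s\<bar>..\<bar>s\<bar>}"
    then have "((\<lambda>\<sigma>. G (\<sigma> + \<tau>) - G \<sigma>) has_real_derivative F (\<sigma> + \<tau>) - F \<sigma>) (at \<sigma>)"
      using \<tau> by (intro DERIV_diff G\<tau> G') (auto simp: a_def b_def)
    then show "((\<lambda>\<sigma>. G (\<sigma> + \<tau>) - G \<sigma>) has_real_derivative 0) (at \<sigma> within {- \<bar>s\<bar>..\<bar>s\<bar>})"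
      using per by (simp add: has_field_derivative_at_within)
  qed simp
  then obtain c where c: "\<And>\<sigma>. \<bar>\<sigma>\<bar> \<le> \<bar>s\<bar> \<Longrightarrow> G (\<sigma> + \<tau>) - G \<sigma> = c"
    by (auto simp: abs_le_iff)
  then show ?thesis using FTC[of s] FTC[of 0] c[of s] c[of 0] by simp
qed

text \<open>
  Shifting a periodic signal rotates the vector of its cosine and sine coefficients. This makes the
  forcing part of the Melnikov function a pure oscillation in the shift.
\<close>
lemma integral_shift_modulated:
  fixes v :: "real \<Rightarrow> real" and \<sigma> :: real
  assumes v: "continuous_on UNIV v" "\<And>t. v (t + \<tau>) = v t" and \<tau>: "\<tau> > 0"
    and k: "k * \<tau> = 2 * real l * pi"
  defines "A \<equiv> integral {0..\<tau>} (\<lambda>t. v t * cos (k * t))"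
    and "B \<equiv> integral {0..\<tau>} (\<lambda>t. v t * sin (k * t))"
  shows "integral {0..\<tau>} (\<lambda>t. v (t + \<sigma>) * cos (k * t)) = A * cos (k * \<sigma>) + B * sin (k * \<sigma>)"
    and "integral {0..\<tau>} (\<lambda>t. v (t + \<sigma>) * sin (k * t)) = B * cos (k * \<sigma>) - A * sin (k * \<sigma>)"
proof -
  have cont [continuous_intros]: "continuous_on {0..\<tau>} v"
    using v(1) by (rule continuous_on_subset) simp
  have int: "(\<lambda>t. v t * cos (k * t) * c) integrable_on {0..\<tau>}"
      "(\<lambda>t. v t * sin (k * t) * c) integrable_on {0..\<tau>}" for c
    by (auto intro!: integrable_continuous_interval continuous_intros)
  have cper: "cos (k * (t + \<tau> - \<sigma>)) = cos (k * (t - \<sigma>))"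
    and sper: "sin (k * (t + \<tau> - \<sigma>)) = sin (k * (t - \<sigma>))" for t
  proof -
    have "k * (t + \<tau> - \<sigma>) = k * (t - \<sigma>) + 2 * real l * pi"
      using k by (simp add: algebra_simps)
    then show "cos (k * (t + \<tau> - \<sigma>)) = cos (k * (t - \<sigma>))" "sin (k * (t + \<tau> - \<sigma>)) = sin (k * (t - \<sigma>))"
      by (simp_all add: cos_add sin_add)
  qed
  have "integral {0..\<tau>} (\<lambda>t. v (t + \<sigma>) * cos (k * (t + \<sigma> - \<sigma>)))
      = integral {0..\<tau>} (\<lambda>t. v t * cos (k * (t - \<sigma>)))"
    by (rule integral_shift_periodic[where F = "\<lambda>t. v t * cos (k * (t - \<sigma>))"])
      (auto simp: v(2) cper intro!: continuous_intros v(1) \<tau>)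
  also have "\<dots> = integral {0..\<tau>} (\<lambda>t. v t * cos (k * t) * cos (k * \<sigma>) + v t * sin (k * t) * sin (k * \<sigma>))"
    by (simp add: right_diff_distrib cos_diff algebra_simps)
  also have "\<dots> = A * cos (k * \<sigma>) + B * sin (k * \<sigma>)"
    unfolding A_def B_def by (simp add: integral_add int)
  finally show "integral {0..\<tau>} (\<lambda>t. v (t + \<sigma>) * cos (k * t)) = A * cos (k * \<sigma>) + B * sin (k * \<sigma>)"
    by simp
  have "integral {0..\<tau>} (\<lambda>t. v (t + \<sigma>) * sin (k * (t + \<sigma> - \<sigma>)))
      = integral {0..\<tau>} (\<lambda>t. v t * sin (k * (t - \<sigma>)))"
    by (rule integral_shift_periodic[where F = "\<lambda>t. v t * sin (k * (t - \<sigma>))"])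
      (auto simp: v(2) sper intro!: continuous_intros v(1) \<tau>)
  also have "\<dots> = integral {0..\<tau>} (\<lambda>t. v t * sin (k * t) * cos (k * \<sigma>) - v t * cos (k * t) * sin (k * \<sigma>))"
    by (simp add: right_diff_distrib sin_diff algebra_simps)
  also have "\<dots> = B * cos (k * \<sigma>) - A * sin (k * \<sigma>)"
    unfolding A_def B_def by (simp add: integral_diff int)
  finally show "integral {0..\<tau>} (\<lambda>t. v (t + \<sigma>) * sin (k * t)) = B * cos (k * \<sigma>) - A * sin (k * \<sigma>)"
    by simp
qed

lemma fourier_coefficients_of_derivative:
  fixes h v :: "real \<Rightarrow> real"
  assumes h: "\<And>t. (h has_real_derivative v t) (at t)" "\<And>t. h (t + \<tau>) = h t"
    and v: "continuous_on UNIV v" and \<tau>: "\<tau> > 0" and k: "k * \<tau> = 2 * real l * pi"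
  shows "integral {0..\<tau>} (\<lambda>t. v t * sin (k * t)) = - k * integral {0..\<tau>} (\<lambda>t. h t * cos (k * t))"
    and "integral {0..\<tau>} (\<lambda>t. v t * cos (k * t)) = k * integral {0..\<tau>} (\<lambda>t. h t * sin (k * t))"
proof -
  have cont [continuous_intros]: "continuous_on {0..\<tau>} v" "continuous_on {0..\<tau>} h"
    using v h(1) by (blast intro: continuous_on_subset continuous_at_imp_continuous_on DERIV_isCont)+
  have int: "(\<lambda>t. v t * sin (k * t)) integrable_on {0..\<tau>}" "(\<lambda>t. v t * cos (k * t)) integrable_on {0..\<tau>}"
      "(\<lambda>t. k * (h t * sin (k * t))) integrable_on {0..\<tau>}" "(\<lambda>t. k * (h t * cos (k * t))) integrable_on {0..\<tau>}"
    by (auto intro!: integrable_continuous_interval continuous_intros)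
  have h\<tau>: "h \<tau> = h 0" using h(2)[of 0] by simp
  have "((\<lambda>t. v t * sin (k * t) + k * (h t * cos (k * t))) has_integral
      (h \<tau> * sin (k * \<tau>) - h 0 * sin (k * 0))) {0..\<tau>}"
  proof (rule fundamental_theorem_of_calculus)
    fix t
    show "((\<lambda>t. h t * sin (k * t)) has_vector_derivative v t * sin (k * t) + k * (h t * cos (k * t)))
        (at t within {0..\<tau>})"
      unfolding has_real_derivative_iff_has_vector_derivative[symmetric]
      by (auto intro!: derivative_eq_intros DERIV_subset[OF h(1)] simp: algebra_simps)
  qed (use \<tau> in simp)
  then have "integral {0..\<tau>} (\<lambda>t. v t * sin (k * t) + k * (h t * cos (k * t))) = 0"
    by (simp add: k integral_unique)
  then show "integral {0..\<tau>} (\<lambda>t. v t * sin (k * t)) = - k * integral {0..\<tau>} (\<lambda>t. h t * cos (k * t))"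
    by (simp add: integral_add int)
  have "((\<lambda>t. v t * cos (k * t) - k * (h t * sin (k * t))) has_integral
      (h \<tau> * cos (k * \<tau>) - h 0 * cos (k * 0))) {0..\<tau>}"
  proof (rule fundamental_theorem_of_calculus)
    fix t
    show "((\<lambda>t. h t * cos (k * t)) has_vector_derivative v t * cos (k * t) - k * (h t * sin (k * t)))
        (at t within {0..\<tau>})"
      unfolding has_real_derivative_iff_has_vector_derivative[symmetric]
      by (auto intro!: derivative_eq_intros DERIV_subset[OF h(1)] simp: algebra_simps)
  qed (use \<tau> in simp)
  then have "integral {0..\<tau>} (\<lambda>t. v t * cos (k * t) - k * (h t * sin (k * t))) = 0"
    by (simp add: k h\<tau> integral_unique)
  then show "integral {0..\<tau>} (\<lambda>t. v t * cos (k * t)) = k * integral {0..\<tau>} (\<lambda>t. h t * sin (k * t))"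
    by (simp add: integral_diff int)
qed

text \<open>
  The two signals have different periods, so they are compared at equal fractions of their periods.
  There the weight \<open>c\<close> is the same for both, and the signals differ by their distance at equal times
  plus the variation of \<open>h0\<close> between the times \<open>P w\<close> and \<open>\<tau> w\<close>.
\<close>
lemma fourier_coefficient_close:
  fixes h h0 c :: "real \<Rightarrow> real"
  assumes P: "P > 0" and \<tau>: "\<tau> > 0"
    and h: "continuous_on {0..P} h" and h0: "continuous_on UNIV h0"
    and c: "continuous_on UNIV c" "\<And>w. \<bar>c w\<bar> \<le> 1"
    and close: "\<And>t. t \<in> {0..P} \<Longrightarrow> \<bar>h t - h0 t\<bar> \<le> a"
    and lip: "\<And>x y. x \<in> {0..P} \<Longrightarrow> y \<in> {0..\<tau>} \<Longrightarrow> \<bar>h0 x - h0 y\<bar> \<le> \<Lambda> * \<bar>x - y\<bar>"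
    and \<Lambda>: "\<Lambda> \<ge> 0"
  shows "\<bar>integral {0..P} (\<lambda>u. h u * c (u / P)) / P - integral {0..\<tau>} (\<lambda>u. h0 u * c (u / \<tau>)) / \<tau>\<bar>
      \<le> a + \<Lambda> * \<bar>P - \<tau>\<bar>"
proof -
  have hc: "continuous_on {0..1} (\<lambda>w. h (P * w))"
    using P by (intro continuous_on_compose2[OF h] continuous_intros) (auto simp: mult_left_le)
  have h0c: "continuous_on {0..1} (\<lambda>w. h0 (\<tau> * w))"
    by (intro continuous_on_compose2[OF h0] continuous_intros) auto
  have cc: "continuous_on S c" for S using c(1) by (rule continuous_on_subset) simp
  have 1: "integral {0..P} (\<lambda>u. h u * c (u / P)) / P = integral {0..1} (\<lambda>w. h (P * w) * c w)"
    using P h by (subst integral_rescale_to_unit[symmetric])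
      (auto intro!: integrable_continuous_interval continuous_intros continuous_on_compose2[OF c(1)])
  have 2: "integral {0..\<tau>} (\<lambda>u. h0 u * c (u / \<tau>)) / \<tau> = integral {0..1} (\<lambda>w. h0 (\<tau> * w) * c w)"
    using \<tau> by (subst integral_rescale_to_unit[symmetric])
      (auto intro!: integrable_continuous_interval continuous_intros continuous_on_compose2[OF c(1)]
         continuous_on_subset[OF h0])
  have "integral {0..1} (\<lambda>w. h (P * w) * c w) - integral {0..1} (\<lambda>w. h0 (\<tau> * w) * c w)
      = integral {0..1} (\<lambda>w. (h (P * w) - h0 (\<tau> * w)) * c w)"
    using hc h0c cc unfolding left_diff_distrib
    by (intro integral_diff[symmetric] integrable_continuous_interval continuous_on_mult)
  also have "norm \<dots> \<le> (a + \<Lambda> * \<bar>P - \<tau>\<bar>) * (1 - 0)"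
  proof (rule integral_bound)
    show "continuous_on {0..1} (\<lambda>w. (h (P * w) - h0 (\<tau> * w)) * c w)"
      using hc h0c cc by (intro continuous_on_mult continuous_on_diff)
    fix w :: real assume w: "w \<in> {0..1}"
    then have Pw: "P * w \<in> {0..P}" and \<tau>w: "\<tau> * w \<in> {0..\<tau>}" using P \<tau> by (auto simp: mult_left_le)
    have "\<bar>h0 (P * w) - h0 (\<tau> * w)\<bar> \<le> \<Lambda> * (\<bar>P - \<tau>\<bar> * w)"
      using lip[OF Pw \<tau>w] w by (simp add: abs_mult flip: left_diff_distrib)
    also have "\<dots> \<le> \<Lambda> * \<bar>P - \<tau>\<bar>" using w \<Lambda> by (intro mult_left_mono) (auto simp: mult_left_le)
    finally have "\<bar>h (P * w) - h0 (\<tau> * w)\<bar> \<le> a + \<Lambda> * \<bar>P - \<tau>\<bar>" using close[OF Pw] by linarith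
    then show "norm ((h (P * w) - h0 (\<tau> * w)) * c w) \<le> a + \<Lambda> * \<bar>P - \<tau>\<bar>"
      using c(2)[of w] mult_mono[of "\<bar>h (P * w) - h0 (\<tau> * w)\<bar>" "a + \<Lambda> * \<bar>P - \<tau>\<bar>" "\<bar>c w\<bar>" 1]
      by (auto simp: abs_mult)
  qed simp
  finally show ?thesis unfolding 1 2 by simp
qed

section \<open>The phase of a harmonic\<close>

text \<open>
  Polar coordinates of the point \<open>(a, b)\<close> in the upper half plane. The polar angle is written as \<open>\<pi>/2\<close>
  minus the deviation from the vertical axis, which is small when \<open>a / b\<close> is.
\<close>
lemma quadrature_identities:
  fixes a b :: real
  assumes b: "b > 0"
  defines "r \<equiv> b * sqrt (1 + (a / b)\<^sup>2)" and "\<phi> \<equiv> pi / 2 - arctan (a / b)"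
  shows "r > 0" "r * cos \<phi> = a" "r * sin \<phi> = b"
proof -
  have pos: "sqrt (1 + (a / b)\<^sup>2) > 0" by (simp add: add_pos_nonneg)
  show "r > 0" using b pos by (simp add: r_def)
  have "cos \<phi> = sin (arctan (a / b))" "sin \<phi> = cos (arctan (a / b))"
    unfolding \<phi>_def by (simp_all add: cos_diff sin_diff)
  then show "r * cos \<phi> = a" "r * sin \<phi> = b"
    using b pos unfolding r_def cos_arctan sin_arctan by simp_all
qed

lemma phase_lag_of_coefficients:
  assumes h: "\<And>t. h t = a * cos (2 * pi / T * t) + b * sin (2 * pi / T * t)" and b: "b > 0"
  shows "has_phase_lag h T (pi / 2 - arctan (a / b))"
proof -
  note q = quadrature_identities[OF b, of a]
  have "h t = (b * sqrt (1 + (a / b)\<^sup>2)) * cos (2 * pi / T * t - (pi / 2 - arctan (a / b)))" for t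
    unfolding h cos_diff[of "2 * pi / T * t"]
    using arg_cong2[OF q(2,3), of "\<lambda>x y. x * cos (2 * pi / T * t) + y * sin (2 * pi / T * t)"]
    by (simp add: algebra_simps)
  then show ?thesis using q(1) unfolding has_phase_lag_def by blast
qed

lemma phase_lead_of_coefficients:
  assumes h: "\<And>t. h t = a * cos (2 * pi / T * t) - b * sin (2 * pi / T * t)" and b: "b > 0"
  shows "has_phase_lead h T (pi / 2 - arctan (a / b))"
proof -
  note q = quadrature_identities[OF b, of a]
  have "h t = (b * sqrt (1 + (a / b)\<^sup>2)) * cos (2 * pi / T * t + (pi / 2 - arctan (a / b)))" for t
    unfolding h cos_add[of "2 * pi / T * t"]
    using arg_cong2[OF q(2,3), of "\<lambda>x y. x * cos (2 * pi / T * t) - y * sin (2 * pi / T * t)"]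
    by (simp add: algebra_simps)
  then show ?thesis using q(1) unfolding has_phase_lead_def by blast
qed

text \<open>
  Because \<open>b\<close> stays above \<open>b0 / 2\<close>, the quotient \<open>a / b\<close> inherits the order of \<open>a\<close>, and the arc
  tangent does not increase absolute values.
\<close>
lemma quadrature_asymptotics:
  fixes a b :: "real \<Rightarrow> real"
  assumes a: "\<forall>\<^sub>F \<epsilon> in at_right 0. \<bar>a \<epsilon>\<bar> \<le> K * \<epsilon>"
    and b: "\<forall>\<^sub>F \<epsilon> in at_right 0. \<bar>b \<epsilon> - b0\<bar> \<le> K * \<epsilon>" and b0: "b0 > 0" and K: "K \<ge> 0"
  shows "\<forall>\<^sub>F \<epsilon> in at_right 0. b \<epsilon> > 0"
    and "(\<lambda>\<epsilon>. (pi / 2 - arctan (a \<epsilon> / b \<epsilon>)) - pi / 2) \<in> O[at_right 0](\<lambda>\<epsilon>. \<epsilon>)"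
proof -
  \<comment> \<open>Adding \<open>1\<close> to \<open>K\<close> keeps the quotient meaningful when \<open>K = 0\<close>.\<close>
  have "\<forall>\<^sub>F \<epsilon> in at_right (0::real). \<epsilon> \<in> {0<..<b0 / (2 * (K + 1))}"
    using b0 K by (intro eventually_at_right_real) simp
  with a b have ev: "\<forall>\<^sub>F \<epsilon> in at_right 0. b \<epsilon> > b0 / 2 \<and> \<bar>a \<epsilon>\<bar> \<le> K * \<epsilon> \<and> \<epsilon> > 0"
  proof eventually_elim
    case (elim \<epsilon>)
    then have "(K + 1) * \<epsilon> < b0 / 2" using K by (simp add: field_simps)
    then have "K * \<epsilon> < b0 / 2" using elim by (simp add: algebra_simps)
    then show ?case using elim by (auto simp: abs_le_iff)
  qed
  then show "\<forall>\<^sub>F \<epsilon> in at_right 0. b \<epsilon> > 0"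
    using b0 by (auto elim!: eventually_mono)
  show "(\<lambda>\<epsilon>. (pi / 2 - arctan (a \<epsilon> / b \<epsilon>)) - pi / 2) \<in> O[at_right 0](\<lambda>\<epsilon>. \<epsilon>)"
  proof (rule landau_o.bigI[of "(K + 1) / (b0 / 2)"])
    show "\<forall>\<^sub>F \<epsilon> in at_right 0. norm ((pi / 2 - arctan (a \<epsilon> / b \<epsilon>)) - pi / 2) \<le> (K + 1) / (b0 / 2) * norm \<epsilon>"
      using ev
    proof eventually_elim
      case (elim \<epsilon>)
      have "\<bar>arctan (a \<epsilon> / b \<epsilon>)\<bar> \<le> \<bar>a \<epsilon>\<bar> / \<bar>b \<epsilon>\<bar>" using abs_arctan_le[of "a \<epsilon> / b \<epsilon>"] by simp
      also have "\<dots> \<le> ((K + 1) * \<epsilon>) / (b0 / 2)"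
        using elim b0 K by (intro frac_le) (auto simp: algebra_simps)
      also have "\<dots> = (K + 1) / (b0 / 2) * norm \<epsilon>" using elim by simp
      finally have "\<bar>arctan (a \<epsilon> / b \<epsilon>)\<bar> \<le> (K + 1) / (b0 / 2) * norm \<epsilon>" .
      moreover have "norm ((pi / 2 - arctan (a \<epsilon> / b \<epsilon>)) - pi / 2) = \<bar>arctan (a \<epsilon> / b \<epsilon>)\<bar>" by simp
      ultimately show ?case by (simp only:)
    qed
  qed (use b0 K in simp)
qed

lemma bigo_id_at_right_0E:
  fixes f :: "real \<Rightarrow> real"
  assumes "f \<in> O[at_right 0](\<lambda>\<epsilon>. \<epsilon>)"
  obtains c where "c > 0" "\<forall>\<^sub>F \<epsilon> in at_right 0. \<bar>f \<epsilon>\<bar> \<le> c * \<epsilon>" "(f \<longlongrightarrow> 0) (at_right 0)"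
proof -
  obtain c where c: "c > 0" "\<forall>\<^sub>F \<epsilon> in at_right 0. norm (f \<epsilon>) \<le> c * norm \<epsilon>"
    using assms unfolding bigo_def by auto
  have bound: "\<forall>\<^sub>F \<epsilon> in at_right 0. \<bar>f \<epsilon>\<bar> \<le> c * \<epsilon>"
    using c(2) eventually_at_right_less[of "0::real"] by eventually_elim simp
  have "((\<lambda>\<epsilon>. c * \<epsilon>) \<longlongrightarrow> c * 0) (at_right 0)" by (intro tendsto_intros)
  then have "((\<lambda>\<epsilon>. c * \<epsilon>) \<longlongrightarrow> 0) (at_right 0)" by simp
  then have "(f \<longlongrightarrow> 0) (at_right 0)"
    by (rule Lim_null_comparison[rotated]) (use bound in simp)
  with c(1) bound show thesis by (rule that)
qed

section \<open>Quadratic zeros of the Melnikov function\<close>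

lemma fst_conservative_field [simp]: "fst (conservative_field M V x) = snd x"
  by (simp add: conservative_field_def split: prod.split)

lemma observed_coordinate_derivative:
  assumes "(x has_vector_derivative x') (at t)"
  shows "((\<lambda>t. fst (x t) \<bullet> w) has_real_derivative fst x' \<bullet> w) (at t)"
  unfolding has_real_derivative_iff_has_vector_derivative
  by (rule bounded_linear.has_vector_derivative[OF bounded_linear_compose[OF
        bounded_linear_inner_left bounded_linear_fst] assms])

text \<open>
  As a function of the shift, the Melnikov function is \<open>e (a cos k\<sigma> + b sin k\<sigma>) - R\<close>. Integration
  by parts identifies the two integrals below, up to nonzero constants, with the \<open>\<sigma>\<close>-derivative and the
  value of the oscillating part at \<open>s\<close>.
\<close>
lemma melnikov_quadratic_zero_quadrature:
  fixes x0 :: "real \<Rightarrow> 'n::finite state"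
  assumes x0: "periodic_orbit U (conservative_field M V) \<tau> p x0"
    and C: "smooth_dissipative U C" and l: "l \<ge> 1"
    and zero: "quadratic_zero (melnikov l \<tau> x0 C fe) s e" and e: "e \<noteq> 0"
  shows "integral {0..\<tau>} (\<lambda>t. fst (x0 (t + s)) \<bullet> fe * cos (2 * real l * pi / \<tau> * t)) = 0"
    and "e * (2 * real l * pi / \<tau>) * integral {0..\<tau>} (\<lambda>t. fst (x0 (t + s)) \<bullet> fe * sin (2 * real l * pi / \<tau> * t))
      = resistance \<tau> x0 C"
proof -
  define k where "k = 2 * real l * pi / \<tau>"
  have dx0: "(x0 has_vector_derivative conservative_field M V (x0 t)) (at t)" and x0U: "fst (x0 t) \<in> U"
    and per: "x0 (t + \<tau>) = x0 t" and \<tau>: "\<tau> > 0" for t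
    using x0 unfolding periodic_orbit_def by blast+
  have k: "k > 0" "k * \<tau> = 2 * real l * pi" using l \<tau> by (simp_all add: k_def)
  have contx0 [continuous_intros]: "continuous_on X x0" for X
    using dx0 by (intro continuous_at_imp_continuous_on ballI has_vector_derivative_continuous)
  define v where "v t = snd (x0 t) \<bullet> fe" for t
  define power where "power t = snd (x0 t) \<bullet> C (fst (x0 t)) (snd (x0 t))" for t
  have contv: "continuous_on UNIV v"
    unfolding v_def by (intro continuous_intros)
  have "continuous_on (U \<times> UNIV) (\<lambda>(q, v). C q v)"
    using C unfolding smooth_dissipative_def by (metis Ck_along.simps(1))
  then have "continuous_on UNIV (\<lambda>t. (\<lambda>(q, v). C q v) (x0 t))"
    by (rule continuous_on_compose2[OF _ contx0]) (use x0U in \<open>simp add: image_subset_iff mem_Times_iff\<close>)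
  then have "continuous_on UNIV (\<lambda>t. C (fst (x0 t)) (snd (x0 t)))"
    by (simp add: case_prod_beta)
  then have contpow: "continuous_on UNIV power"
    unfolding power_def by (intro continuous_intros)
  define a where "a = integral {0..\<tau>} (\<lambda>t. v t * cos (k * t))"
  define b where "b = integral {0..\<tau>} (\<lambda>t. v t * sin (k * t))"
  have vper: "v (t + \<tau>) = v t" for t by (simp add: v_def per)
  note shifted = integral_shift_modulated[OF contv vper \<tau> k(2), folded a_def b_def]
  have formula: "melnikov l \<tau> x0 C fe \<sigma> e = e * (a * cos (k * \<sigma>) + b * sin (k * \<sigma>)) - resistance \<tau> x0 C" for \<sigma>
  proof -
    have "melnikov l \<tau> x0 C fe \<sigma> e = integral {0..\<tau>} (\<lambda>t. e * (v (t + \<sigma>) * cos (k * t)) - power (t + \<sigma>))"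
      unfolding melnikov_def k_def v_def power_def
      by (intro integral_cong) (simp add: inner_diff_right algebra_simps)
    also have "\<dots> = integral {0..\<tau>} (\<lambda>t. e * (v (t + \<sigma>) * cos (k * t))) - integral {0..\<tau>} (\<lambda>t. power (t + \<sigma>))"
      by (intro integral_diff integrable_continuous_interval)
        (auto intro!: continuous_intros continuous_on_compose2[OF contv] continuous_on_compose2[OF contpow])
    also have "integral {0..\<tau>} (\<lambda>t. power (t + \<sigma>)) = resistance \<tau> x0 C"
      unfolding resistance_def power_def[symmetric]
      by (rule integral_shift_periodic[OF contpow _ \<tau>]) (simp add: power_def per)
    finally show ?thesis by (simp add: shifted)
  qed
  have "(melnikov l \<tau> x0 C fe s e) = 0" and "deriv (\<lambda>\<sigma>. melnikov l \<tau> x0 C fe \<sigma> e) s = 0"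
    using zero unfolding quadratic_zero_def by auto
  moreover have "((\<lambda>\<sigma>. melnikov l \<tau> x0 C fe \<sigma> e) has_real_derivative e * k * (b * cos (k * s) - a * sin (k * s))) (at s)"
    unfolding formula by (auto intro!: derivative_eq_intros simp: algebra_simps)
  ultimately have amplitude: "e * (a * cos (k * s) + b * sin (k * s)) = resistance \<tau> x0 C"
    and phase: "b * cos (k * s) - a * sin (k * s) = 0"
    using formula[of s] k(1) e by (auto dest!: DERIV_imp_deriv)
  define h where "h t = fst (x0 (t + s)) \<bullet> fe" for t
  have dh: "(h has_real_derivative v (t + s)) (at t)" for t
    using observed_coordinate_derivative[OF dx0[of "t + s"], of fe]
    unfolding h_def v_def by (subst (asm) DERIV_shift) simp
  have hper: "h (t + \<tau>) = h t" for t using per[of "t + s"] by (simp add: h_def algebra_simps)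
  have contvs: "continuous_on UNIV (\<lambda>t. v (t + s))"
    by (intro continuous_on_compose2[OF contv] continuous_intros) auto
  note parts = fourier_coefficients_of_derivative[OF dh hper
contvs \<tau> k(2), unfolded shifted]
  have "- k * integral {0..\<tau>} (\<lambda>t. h t * cos (k * t)) = 0"
    using parts(1) phase by simp
  then have "integral {0..\<tau>} (\<lambda>t. h t * cos (k * t)) = 0" using k(1) by simp
  then show "integral {0..\<tau>} (\<lambda>t. fst (x0 (t + s)) \<bullet> fe * cos (2 * real l * pi / \<tau> * t)) = 0"
    by (simp add: h_def k_def)
  have "e * (k * integral {0..\<tau>} (\<lambda>t. h t * sin (k * t))) = resistance \<tau> x0 C"
    using parts(2) amplitude by simp
  then show "e * (2 * real l * pi / \<tau>) * integral {0..\<tau>} (\<lambda>t. fst (x0 (t + s)) \<bullet> fe * sin (2 * real l * pi / \<tau> * t))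
      = resistance \<tau> x0 C"
    by (simp add: h_def k_def mult.assoc)
qed

section \<open>Quadrature of the forced response\<close>

theorem proposition4p3:
  fixes U :: "(real^'n) set"
    and M :: "real^'n \<Rightarrow> real^'n^'n" and V :: "real^'n \<Rightarrow> real"
    and Q :: "'n perturbation" and C :: "real^'n \<Rightarrow> real^'n \<Rightarrow> real^'n"
    and fe :: "real^'n" and \<epsilon>0 \<tau> s e :: real and r l :: nat
    and p :: "'n state" and x0 :: "real \<Rightarrow> 'n state"
    and \<xi> :: "real \<Rightarrow> 'n state" and T A :: "real \<Rightarrow> real" and X :: "real \<Rightarrow> real \<Rightarrow> 'n state"
  assumes "mechanical_system U M V Q \<epsilon>0 r"
    and "l \<ge> 1"
    and "norm fe = 1"
    and "smooth_dissipative U C"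
    and "\<And>q v t T' e'. q \<in> U \<Longrightarrow> T' > 0 \<Longrightarrow>
           Q q v t T' e' 0 = (e' * cos (2 * pi / T' * t)) *\<^sub>R fe - C q v"
    and "periodic_orbit U (conservative_field M V) \<tau> p x0"
    and "one_normal (conservative_field M V) \<tau> p x0"
    and "quadratic_zero (melnikov l \<tau> x0 C fe) s e"
    and "perturbed_orbit_family U M V Q l \<tau> x0 s e \<xi> T A X"
  shows "(e * resistance \<tau> x0 C > 0 \<longrightarrow>
      (\<exists>\<phi>. (\<lambda>\<epsilon>. \<phi> \<epsilon> - pi / 2) \<in> O[at_right 0](\<lambda>\<epsilon>. \<epsilon>) \<and>
        (\<forall>\<^sub>F \<epsilon> in at_right 0.
           has_phase_lag (harmonic l (real l * T \<epsilon>) (\<lambda>t. fst (X \<epsilon> t) \<bullet> fe)) (T \<epsilon>) (\<phi> \<epsilon>)))) \<and>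
    (e * resistance \<tau> x0 C < 0 \<longrightarrow>
      (\<exists>\<phi>. (\<lambda>\<epsilon>. \<phi> \<epsilon> - pi / 2) \<in> O[at_right 0](\<lambda>\<epsilon>. \<epsilon>) \<and>
        (\<forall>\<^sub>F \<epsilon> in at_right 0.
           has_phase_lead (harmonic l (real l * T \<epsilon>) (\<lambda>t. fst (X \<epsilon> t) \<bullet> fe)) (T \<epsilon>) (\<phi> \<epsilon>))))"
proof -
  let ?f = "conservative_field M V"
  note family = assms(9)[unfolded perturbed_orbit_family_def perturbed_trajectory_def]
  have dx0: "(x0 has_vector_derivative ?f (x0 t)) (at t)" and x0U: "fst (x0 t) \<in> U"
    and per: "x0 (t + \<tau>) = x0 t" and \<tau>: "\<tau> > 0" for t
    using assms(6) unfolding periodic_orbit_def by blast+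
  have l: "real l > 0" using assms(2) by simp
  obtain m where m: "r = Suc m" using assms(1) by (cases r) (auto simp: mechanical_system_def)
  have S: "open (U \<times> UNIV :: 'n state set)" and f: "Ck (Suc m) (U \<times> UNIV) ?f" and \<epsilon>0: "\<epsilon>0 > 0"
    and g: "continuous_on ((U \<times> UNIV) \<times> UNIV \<times> {0<..} \<times> UNIV \<times> {0..<\<epsilon>0}) (perturbing_field M Q)"
    using assms(1) Ck_along_imp_continuous_on
    unfolding mechanical_system_def m perturbing_domain_def by (auto intro: open_Times)
  obtain c where c: "c > 0" and init': "\<forall>\<^sub>F \<epsilon> in at_right 0. \<bar>norm (\<xi> \<epsilon> - x0 s)\<bar> \<le> c * \<epsilon>"
    using family bigo_id_at_right_0E by blast
  obtain c' where c': "c' > 0" and period: "\<forall>\<^sub>F \<epsilon> in at_right 0. \<bar>real l * T \<epsilon> - \<tau>\<bar> \<le> c' * \<epsilon>"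
    and lT: "((\<lambda>\<epsilon>. real l * T \<epsilon> - \<tau>) \<longlongrightarrow> 0) (at_right 0)"
    using family bigo_id_at_right_0E by blast
  have A: "(A \<longlongrightarrow> e) (at_right 0)"
    using family bigo_id_at_right_0E LIM_zero_cancel by blast
  have "((\<lambda>\<epsilon>. ((real l * T \<epsilon> - \<tau>) + \<tau>) / real l) \<longlongrightarrow> (0 + \<tau>) / real l) (at_right 0)"
    using l by (intro tendsto_intros lT) simp
  then have T: "(T \<longlongrightarrow> \<tau> / real l) (at_right 0)" using l by simp
  have X: "\<forall>\<^sub>F \<epsilon> in at_right 0. T \<epsilon> > 0 \<and> X \<epsilon> 0 = \<xi> \<epsilon> \<and> (\<forall>t.
      (X \<epsilon> has_vector_derivative ?f (X \<epsilon> t) + \<epsilon> *\<^sub>R perturbing_field M Q (X \<epsilon> t, t, T \<epsilon>, A \<epsilon>, \<epsilon>)) (at t))"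
    using family by (auto elim!: eventually_mono)
  have init: "\<forall>\<^sub>F \<epsilon> in at_right 0. norm (X \<epsilon> 0 - x0 s) \<le> c * \<epsilon>"
    using X init' by eventually_elim simp
  \<comment> \<open>The length \<open>\<tau> + 1\<close> covers the period \<open>l T(\<epsilon>)\<close> for all small \<open>\<epsilon>\<close>.\<close>
  obtain K where K: "K \<ge> 0"
    and close: "\<forall>\<^sub>F \<epsilon> in at_right 0. \<forall>t\<in>{0..\<tau> + 1}. norm (X \<epsilon> t - x0 (t + s)) \<le> K * \<epsilon>"
  proof (rule perturbed_solutions_close[where X = X and T = T and A = A and s = s
        and c = c and H = "\<tau> + 1", OF S f g \<epsilon>0 _ dx0 _ T _ A init])
    show "x0 t \<in> U \<times> UNIV" for t using x0U by (simp add: mem_Times_iff)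
    show "\<forall>\<^sub>F \<epsilon> in at_right 0. \<forall>t. (X \<epsilon> has_vector_derivative
        ?f (X \<epsilon> t) + \<epsilon> *\<^sub>R perturbing_field M Q (X \<epsilon> t, t, T \<epsilon>, A \<epsilon>, \<epsilon>)) (at t)"
      using X by (auto elim!: eventually_mono)
  qed (use \<tau> l c in auto)
  define h0 where "h0 t = fst (x0 (t + s)) \<bullet> fe" for t
  define h where "h \<epsilon> t = fst (X \<epsilon> t) \<bullet> fe" for \<epsilon> t
  have dh0: "(h0 has_real_derivative snd (x0 (t + s)) \<bullet> fe) (at t)" for t
    using observed_coordinate_derivative[OF dx0[of "t + s"], of fe]
    unfolding h0_def by (subst (asm) DERIV_shift) simp
  have conth0: "continuous_on UNIV h0"
    using dh0 by (blast intro: continuous_at_imp_continuous_on DERIV_isCont)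
  obtain \<Lambda> where \<Lambda>: "\<Lambda> > 0" "\<And>t. t \<in> {0..\<tau> + 1} \<Longrightarrow> \<bar>snd (x0 (t + s)) \<bullet> fe\<bar> \<le> \<Lambda>"
  proof -
    have "continuous_on UNIV x0"
      using dx0 by (intro continuous_at_imp_continuous_on ballI has_vector_derivative_continuous)
    then have "continuous_on {0..\<tau> + 1} (\<lambda>t. snd (x0 (t + s)) \<bullet> fe)"
      by (auto intro!: continuous_intros continuous_on_compose2[of UNIV x0])
    then have "bounded ((\<lambda>t. snd (x0 (t + s)) \<bullet> fe) ` {0..\<tau> + 1})"
      by (intro compact_imp_bounded compact_continuous_image) auto
    then show thesis using that unfolding bounded_pos by auto
  qed
  have lip: "\<bar>h0 x - h0 y\<bar> \<le> \<Lambda> * \<bar>x - y\<bar>" if "x \<in> {0..\<tau> + 1}" "y \<in> {0..\<tau> + 1}" for x y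
    using field_differentiable_bound[of "{0..\<tau> + 1}" h0 "\<lambda>t. snd (x0 (t + s)) \<bullet> fe" \<Lambda> y x] that \<Lambda>(2)
    by (auto simp: abs_minus_commute intro!: has_field_derivative_at_within dh0)
  define a where "a \<epsilon> = 2 / (real l * T \<epsilon>) *
    integral {0..real l * T \<epsilon>} (\<lambda>u. h \<epsilon> u * cos (2 * real l * pi / (real l * T \<epsilon>) * u))" for \<epsilon>
  define b where "b \<epsilon> = 2 / (real l * T \<epsilon>) *
    integral {0..real l * T \<epsilon>} (\<lambda>u. h \<epsilon> u * sin (2 * real l * pi / (real l * T \<epsilon>) * u))" for \<epsilon>
  define a0 where "a0 = 2 / \<tau> * integral {0..\<tau>} (\<lambda>t. h0 t * cos (2 * real l * pi / \<tau> * t))"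
  define b0 where "b0 = 2 / \<tau> * integral {0..\<tau>} (\<lambda>t. h0 t * sin (2 * real l * pi / \<tau> * t))"
  \<comment> \<open>\<open>K\<close> accounts for the distance of the motions at equal times and \<open>\<Lambda> * c'\<close> for the change of the
    period; the factor \<open>2\<close> is the normalisation of the Fourier coefficients.\<close>
  define B where "B = 2 * (K + \<Lambda> * c')"
  have "\<forall>\<^sub>F \<epsilon> in at_right 0. real l * T \<epsilon> - \<tau> < 1"
    using lT by (rule order_tendstoD) simp
  with X close period have coeffs: "\<forall>\<^sub>F \<epsilon> in at_right 0. \<bar>a \<epsilon> - a0\<bar> \<le> B * \<epsilon> \<and> \<bar>b \<epsilon> - b0\<bar> \<le> B * \<epsilon>"
  proof eventually_elim
    case (elim \<epsilon>)
    define P where "P = real l * T \<epsilon>"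
    have P: "P > 0" "P < \<tau> + 1" using elim l by (auto simp: P_def)
    have conth: "continuous_on {0..P} (h \<epsilon>)"
      using elim observed_coordinate_derivative unfolding h_def
      by (blast intro: continuous_at_imp_continuous_on DERIV_isCont)
    have near: "\<bar>h \<epsilon> t - h0 t\<bar> \<le> K * \<epsilon>" if "t \<in> {0..P}" for t
    proof -
      have "\<bar>h \<epsilon> t - h0 t\<bar> \<le> norm (fst (X \<epsilon> t - x0 (t + s))) * norm fe"
        unfolding h_def h0_def by (simp add: Cauchy_Schwarz_ineq2 flip: inner_diff_left)
      also have "\<dots> \<le> norm (X \<epsilon> t - x0 (t + s))"
        using assms(3) norm_fst_le[of "fst (X \<epsilon> t - x0 (t + s))" "snd (X \<epsilon> t - x0 (t + s))"]
        by (simp del: fst_diff snd_diff)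
      finally show ?thesis using elim that P(2) by force
    qed
    have bound: "2 * (K * \<epsilon> + \<Lambda> * \<bar>P - \<tau>\<bar>) \<le> B * \<epsilon>"
      using elim \<Lambda>(1) mult_left_mono[of "\<bar>P - \<tau>\<bar>" "c' * \<epsilon>" \<Lambda>] by (simp add: B_def P_def algebra_simps)
    have main: "\<bar>2 / P * integral {0..P} (\<lambda>u. h \<epsilon> u * w (2 * real l * pi / P * u)) -
        2 / \<tau> * integral {0..\<tau>} (\<lambda>t. h0 t * w (2 * real l * pi / \<tau> * t))\<bar> \<le> B * \<epsilon>"
      if w: "continuous_on UNIV w" "\<And>x. \<bar>w x\<bar> \<le> 1" for w :: "real \<Rightarrow> real"
    proof -
      have "\<bar>integral {0..P} (\<lambda>u. h \<epsilon> u * w (2 * real l * pi * (u / P))) / P -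
          integral {0..\<tau>} (\<lambda>u. h0 u * w (2 * real l * pi * (u / \<tau>))) / \<tau>\<bar> \<le> K * \<epsilon> + \<Lambda> * \<bar>P - \<tau>\<bar>"
        using P \<tau> conth conth0 w near lip \<Lambda>(1)
        by (intro fourier_coefficient_close[where c = "\<lambda>x. w (2 * real l * pi * x)"])
          (auto intro!: continuous_intros continuous_on_compose2[OF w(1)])
      with bound show ?thesis by (simp add: field_simps abs_le_iff)
    qed
    have "continuous_on UNIV (cos :: real \<Rightarrow> real)" "continuous_on UNIV (sin :: real \<Rightarrow> real)"
      by (auto intro!: continuous_at_imp_continuous_on)
    from main[OF this(1)] main[OF this(2)] show ?case
      unfolding a_def b_def a0_def b0_def P_def[symmetric] by simp
  qed
  \<comment> \<open>The \<open>l\<close>-th harmonic on a period \<open>l T\<close> has the angular frequency \<open>2 \<pi> / T\<close> of the forcing.\<close>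
  have harm: "\<forall>\<^sub>F \<epsilon> in at_right 0. \<forall>t. harmonic l (real l * T \<epsilon>) (\<lambda>t. fst (X \<epsilon> t) \<bullet> fe) t =
      a \<epsilon> * cos (2 * pi / T \<epsilon> * t) + b \<epsilon> * sin (2 * pi / T \<epsilon> * t)"
    using X
  proof eventually_elim
    case (elim \<epsilon>)
    have "2 * real l * pi / (real l * T \<epsilon>) = 2 * pi / T \<epsilon>" using l by simp
    then show ?case by (simp only: harmonic_def a_def b_def h_def simp_thms)
  qed
  have B: "B \<ge> 0" using K \<Lambda>(1) c' by (simp add: B_def)
  \<comment> \<open>The factor \<open>e\<^sup>2\<close> makes \<open>b0\<close> and \<open>e R\<close> have the same sign.\<close>
  have limit: "a0 = 0" "e * resistance \<tau> x0 C = e\<^sup>2 * (real l * pi) * b0" if "e \<noteq> 0"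
  proof -
    note q = melnikov_quadratic_zero_quadrature[OF assms(6,4,2,8) that]
    show "a0 = 0" unfolding a0_def h0_def q(1) by simp
    show "e * resistance \<tau> x0 C = e\<^sup>2 * (real l * pi) * b0"
      unfolding q(2)[symmetric] b0_def h0_def by (simp add: power2_eq_square)
  qed
  show ?thesis
  proof (intro conjI impI)
    assume R: "e * resistance \<tau> x0 C > 0"
    then have e: "e \<noteq> 0" by auto
    have "0 < e\<^sup>2 * (real l * pi) * b0" using R limit(2)[OF e] by simp
    then have b0: "b0 > 0" by (rule zero_less_mult_pos) (use e l in simp)
    have "\<forall>\<^sub>F \<epsilon> in at_right 0. \<bar>a \<epsilon>\<bar> \<le> B * \<epsilon>" "\<forall>\<^sub>F \<epsilon> in at_right 0. \<bar>b \<epsilon> - b0\<bar> \<le> B * \<epsilon>"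
      using coeffs limit(1)[OF e] by (auto elim!: eventually_mono)
    note q = quadrature_asymptotics[OF this b0 B]
    have "\<forall>\<^sub>F \<epsilon> in at_right 0. has_phase_lag (harmonic l (real l * T \<epsilon>) (\<lambda>t. fst (X \<epsilon> t) \<bullet> fe))
        (T \<epsilon>) (pi / 2 - arctan (a \<epsilon> / b \<epsilon>))"
      using harm q(1)
    proof eventually_elim
      case (elim \<epsilon>)
      show ?case by (rule phase_lag_of_coefficients) (use elim in simp_all)
    qed
    with q(2) show "\<exists>\<phi>. (\<lambda>\<epsilon>. \<phi> \<epsilon> - pi / 2) \<in> O[at_right 0](\<lambda>\<epsilon>. \<epsilon>) \<and>
        (\<forall>\<^sub>F \<epsilon> in at_right 0.
           has_phase_lag (harmonic l (real l * T \<epsilon>) (\<lambda>t. fst (X \<epsilon> t) \<bullet> fe)) (T \<epsilon>) (\<phi> \<epsilon>))"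
      by (intro exI conjI)
  next
    assume R: "e * resistance \<tau> x0 C < 0"
    then have e: "e \<noteq> 0" by auto
    have "0 < e\<^sup>2 * (real l * pi) * (- b0)" using R limit(2)[OF e] by simp
    then have b0: "- b0 > 0" by (rule zero_less_mult_pos) (use e l in simp)
    have "\<forall>\<^sub>F \<epsilon> in at_right 0. \<bar>a \<epsilon>\<bar> \<le> B * \<epsilon>" "\<forall>\<^sub>F \<epsilon> in at_right 0. \<bar>- b \<epsilon> - (- b0)\<bar> \<le> B * \<epsilon>"
      using coeffs limit(1)[OF e] by (auto elim!: eventually_mono)
    note q = quadrature_asymptotics[OF this b0 B]
    have "\<forall>\<^sub>F \<epsilon> in at_right 0. has_phase_lead (harmonic l (real l * T \<epsilon>) (\<lambda>t. fst (X \<epsilon> t) \<bullet> fe))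
        (T \<epsilon>) (pi / 2 - arctan (a \<epsilon> / - b \<epsilon>))"
      using harm q(1)
    proof eventually_elim
      case (elim \<epsilon>)
      show ?case by (rule phase_lead_of_coefficients) (use elim in simp_all)
    qed
    with q(2) show "\<exists>\<phi>. (\<lambda>\<epsilon>. \<phi> \<epsilon> - pi / 2) \<in> O[at_right 0](\<lambda>\<epsilon>. \<epsilon>) \<and>
        (\<forall>\<^sub>F \<epsilon> in at_right 0.
           has_phase_lead (harmonic l (real l * T \<epsilon>) (\<lambda>t. fst (X \<epsilon> t) \<bullet> fe)) (T \<epsilon>) (\<phi> \<epsilon>))"
      by (intro exI conjI)
  qed
qed

end
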